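(* Let $\mathbb{H}$ and $\mathbb{K}$ be connected bipartite graphs with diameters $D(\mathbb{H})$ and $D(\mathbb{K})$, admitting polarities $\rho_H$ and $\rho_K$, and let their polarity quotient graphs $P_H(\mathbb{H})$ and $P_K(\mathbb{K})$ have diameters $D(P_H(\mathbb{H}))$ and $D(P_K(\mathbb{K}))$. Let $P(\mathbb{H}\odot\mathbb{K})$ be the polarity quotient graph of the Reduced-Kronecker product $\mathbb{H}\odot\mathbb{K}$ with respect to the composed polarity $\rho((h,k))=(\rho_H(h),\rho_K(k))$. Then the isomorphic graphs $P_H(\mathbb{H})\otimes P_K(\mathbb{K})$ and $P(\mathbb{H}\odot\mathbb{K})$ have diameter $D$, where $$\max\bigl(D(P_H(\mathbb{H})),D(P_K(\mathbb{K}))\bigr)\le D\le \max\bigl(D(\mathbb{H}),D(\mathbb{K})\bigr)-1.$$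
   Context: Graphs are undirected, without multi-edges; self-loops are allowed (bipartite graphs have none). $D(G)$ denotes the diameter of $G$. Kronecker product: for graphs $H,K$, $H\otimes K$ has vertex set $V(H)\times V(K)$, and $((h_1,k_1),(h_2,k_2))$ is an edge if and only if $(h_1,h_2)\in E(H)$ and $(k_1,k_2)\in E(K)$ (so loops of the factors contribute edges). Polarity: for a bipartite graph $\mathbb{G}$ with parts $A,B$, a polarity is a graph automorphism $\rho$ of $\mathbb{G}$ that is an involution with $\rho(A)=B$ and $\rho(B)=A$. Polarity quotient: $P(\mathbb{G})$ is the graph whose vertices are the orbits $[v]=\{v,\rho(v)\}$, with $[v]$ and $[w]$ adjacent whenever there are $v'\in[v]$, $w'\in[w]$ with $(v',w')\in E(\mathbb{G})$. Multi-edges are merged into one edge, and self-loops (arising when $(v,\rho(v))\in E(\mathbb{G})$) are retained. Reduced-Kronecker product: for connected bipartite $\mathbb{H}$ (parts $A_H,B_H$) and $\mathbb{K}$ (parts $A_K,B_K$), $\mathbb{H}\otimes\mathbb{K}$ has exactly two components, with vertex sets $(A_H\times A_K)\cup(B_H\times B_K)$ and $(A_H\times B_K)\cup(B_H\times A_K)$. When at least one factor has a bipartition-reversing automorphism (in particular a polarity), these components are isomorphic, and $\mathbb{H}\odot\mathbb{K}$ denotes one of them. The map $\rho((h,k))=(\rho_H(h),\rho_K(k))$ restricts to a polarity of each component; it is called the composed polarity. *)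

theory Defs
  imports "Graph_Theory.Graph_Theory"
begin

text \<open>
  An undirected graph without multi-edges, possibly with self-loops, is a symmetric
  digraph on a set of vertex pairs, i.e. a \<^typ>\<open>'a pair_pre_digraph\<close> satisfying
  \<^locale>\<open>pair_sym_digraph\<close>. Neither finiteness nor local finiteness is assumed.
\<close>

text \<open>
  Unit edge weights give the usual graph distance. The diameter is an extended real: it is
  \<open>\<infinity>\<close> for disconnected graphs and for connected graphs of unbounded distance, and
  a natural number for every finite connected graph (the library's notion of connectedness
  includes nonemptiness).
\<close>

definition graph_dist :: "'a pair_pre_digraph \<Rightarrow> 'a \<Rightarrow> 'a \<Rightarrow> ereal" where
  "graph_dist G u v = wf_digraph.\<mu> (with_proj G) (\<lambda>_. 1) u v"

definition diameter :: "'a pair_pre_digraph \<Rightarrow> ereal" where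
  "diameter G = (SUP u\<in>pverts G. SUP v\<in>pverts G. graph_dist G u v)"

definition bipartition :: "'a pair_pre_digraph \<Rightarrow> 'a set \<Rightarrow> 'a set \<Rightarrow> bool" where
  "bipartition G A B \<longleftrightarrow>
     A \<union> B = pverts G \<and> A \<inter> B = {} \<and>
     (\<forall>(u, v)\<in>parcs G. (u \<in> A \<and> v \<in> B) \<or> (u \<in> B \<and> v \<in> A))"

definition graph_automorphism :: "'a pair_pre_digraph \<Rightarrow> ('a \<Rightarrow> 'a) \<Rightarrow> bool" where
  "graph_automorphism G \<rho> \<longleftrightarrow>
     bij_betw \<rho> (pverts G) (pverts G) \<and>
     (\<forall>u\<in>pverts G. \<forall>v\<in>pverts G. (u, v) \<in> parcs G \<longleftrightarrow> (\<rho> u, \<rho> v) \<in> parcs G)"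

definition polarity :: "'a pair_pre_digraph \<Rightarrow> 'a set \<Rightarrow> 'a set \<Rightarrow> ('a \<Rightarrow> 'a) \<Rightarrow> bool" where
  "polarity G A B \<rho> \<longleftrightarrow>
     graph_automorphism G \<rho> \<and> (\<forall>v\<in>pverts G. \<rho> (\<rho> v) = v) \<and> \<rho> ` A = B \<and> \<rho> ` B = A"

definition polarity_quotient :: "('a \<Rightarrow> 'a) \<Rightarrow> 'a pair_pre_digraph \<Rightarrow> 'a set pair_pre_digraph" where
  "polarity_quotient \<rho> G =
     (let orbits = (\<lambda>v. {v, \<rho> v}) ` pverts G in
      \<lparr> pverts = orbits,
        parcs = {(X, Y). X \<in> orbits \<and> Y \<in> orbits \<and> (\<exists>v\<in>X. \<exists>w\<in>Y. (v, w) \<in> parcs G)} \<rparr>)"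

definition kronecker_product ::
    "'a pair_pre_digraph \<Rightarrow> 'b pair_pre_digraph \<Rightarrow> ('a \<times> 'b) pair_pre_digraph" where
  "kronecker_product H K =
     \<lparr> pverts = pverts H \<times> pverts K,
       parcs = {((h1, k1), (h2, k2)) | h1 k1 h2 k2. (h1, h2) \<in> parcs H \<and> (k1, k2) \<in> parcs K} \<rparr>"

text \<open>
  The reduced Kronecker product is only determined up to the choice of one of the two
  connected components of the Kronecker product, hence a predicate on \<open>R\<close>. In a symmetric
  digraph the strongly connected components are the connected components.
\<close>

definition reduced_kronecker_product ::
    "'a pair_pre_digraph \<Rightarrow> 'b pair_pre_digraph \<Rightarrow> ('a \<times> 'b) pair_pre_digraph \<Rightarrow> bool" where
  "reduced_kronecker_product H K R \<longleftrightarrow>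
     with_proj R \<in> pre_digraph.sccs (with_proj (kronecker_product H K))"

end

theory Submission
  imports Defs
begin

text \<open>
  Everything is phrased with walks of an exact length \<open>n\<close>, that is, with pairs in the
  \<open>n\<close>-th relational power of the arc set. Two facts make this effective. A walk in a
  Kronecker product of length \<open>n\<close> is a pair of walks of the same length \<open>n\<close> in the factors
  (\<open>relpow_kronecker_product\<close>). In a connected bipartite graph with a polarity, the parity of a
  walk is determined by the sides of its ends (\<open>walk_parity\<close>), and a walk can be lengthened by
  any even amount by running back and forth along one edge (\<open>walk_pad\<close>).

  Consequently the two components of the Kronecker product are told apart by whether the two
  coordinates lie on corresponding sides. Applying a polarity to one coordinate
  switches the component, so of the four vertices with coordinates in two given orbits
  \<open>X\<close> and \<open>Y\<close> exactly two lie in \<open>R\<close>, and these form one orbit of the composed polarity.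
  The map \<open>(X, Y) \<mapsto> X \<times> Y \<inter> pverts R\<close> is the isomorphism; an edge of the Kronecker product
  outside \<open>R\<close> is moved into \<open>R\<close> by applying the polarity to its first coordinate, which does not
  change the orbits involved.

  Lower bound: the projections of a product onto its factors are surjective homomorphisms, and
  a surjective homomorphism cannot increase the diameter (\<open>diameter_le_of_surj_hom\<close>).

  Upper bound: let the larger diameter be finite with integer part \<open>m + 1\<close>. A vertex \<open>u\<close> is at distance at
  most \<open>m + 1\<close> from both \<open>v\<close> and its image under the polarity, and these distances have different
  parities. So one of them has the parity of \<open>m\<close>, hence is at most \<open>m\<close>, and padding turns the
  shortest walk into one of length exactly \<open>m\<close>. Thus in each quotient any two vertices are joined
  by a walk of length exactly \<open>m\<close> (\<open>quotient_walk_of_length\<close>), and the exact common length lets the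
  two walks be combined into a walk of length \<open>m\<close> in the product.
\<close>

section \<open>Distances, walks and homomorphisms\<close>

lemma (in pair_wf_digraph) awalk_length_iff_relpow:
  "(\<exists>p. awalk u p v \<and> length p = n) \<longleftrightarrow> u \<in> pverts G \<and> (u, v) \<in> parcs G ^^ n"
proof (induction n arbitrary: u)
  case 0
  then show ?case by (auto simp: awalk_Nil_iff)
next
  case (Suc n)
  have "(\<exists>p. awalk u p v \<and> length p = Suc n) \<longleftrightarrow>
      (\<exists>w. (u, w) \<in> parcs G \<and> (\<exists>p. awalk w p v \<and> length p = n))"
  proof safe
    fix p assume "awalk u p v" "length p = Suc n"
    then obtain e q where "p = e # q" "length q = n" "e \<in> parcs G" "fst e = u" "awalk (snd e) q v"
      by (auto simp: length_Suc_conv awalk_Cons_iff)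
    then show "\<exists>w. (u, w) \<in> parcs G \<and> (\<exists>p. awalk w p v \<and> length p = n)"
      by (metis prod.collapse)
  next
    fix w p assume "(u, w) \<in> parcs G" "awalk w p v" "n = length p"
    then have "awalk u ((u, w) # p) v \<and> length ((u, w) # p) = Suc (length p)"
      by (simp add: awalk_Cons_iff)
    then show "\<exists>q. awalk u q v \<and> length q = Suc (length p)" ..
  qed
  also have "\<dots> \<longleftrightarrow> (\<exists>w. (u, w) \<in> parcs G \<and> (w, v) \<in> parcs G ^^ n)"
    using Suc.IH in_arcsD2 by blast
  also have "\<dots> \<longleftrightarrow> u \<in> pverts G \<and> (u, v) \<in> parcs G ^^ Suc n"
    by (metis in_arcsD1 relpow_Suc_D2 relpow_Suc_I2)
  finally show ?case .
qed

lemma (in pair_wf_digraph) graph_dist_eq_INF_relpow: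
  assumes "u \<in> pverts G"
  shows "graph_dist G u v = (INF n\<in>{n. (u, v) \<in> parcs G ^^ n}. ereal (real n))"
proof -
  have cost: "awalk_cost (\<lambda>_. 1) p = real (length p)" for p :: "('a \<times> 'a) list"
    by (induction p) auto
  have "graph_dist G u v = (INF p\<in>{p. awalk u p v}. ereal (real (length p)))"
    unfolding graph_dist_def \<mu>_def cost ..
  also have "\<dots> = Inf ((\<lambda>n. ereal (real n)) ` length ` {p. awalk u p v})"
    by (simp add: image_image)
  also have "length ` {p. awalk u p v} = {n. (u, v) \<in> parcs G ^^ n}"
    using awalk_length_iff_relpow[of u v] assms by (auto simp: image_iff) metis+
  finally show ?thesis .
qed

lemma (in pair_wf_digraph) graph_dist_le_relpow:
  assumes "u \<in> pverts G" "(u, v) \<in> parcs G ^^ n"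
  shows "graph_dist G u v \<le> ereal (real n)"
  unfolding graph_dist_eq_INF_relpow[OF assms(1)] using assms(2) by (auto intro: INF_lower)

text \<open>
  The infimum is over natural numbers, so a finite distance is realised by a walk. The
  bound is an arbitrary real because it will be a diameter, which is only known as an
  extended real.
\<close>

lemma (in pair_wf_digraph) graph_dist_attained:
  assumes "u \<in> pverts G" "graph_dist G u v \<le> ereal x"
  obtains n where "(u, v) \<in> parcs G ^^ n" "real n \<le> x"
proof -
  let ?W = "{n. (u, v) \<in> parcs G ^^ n}"
  have "?W \<noteq> {}"
  proof
    assume "?W = {}"
    then show False
      using assms(2) unfolding graph_dist_eq_INF_relpow[OF assms(1)] by (simp add: top_ereal_def)
  qed
  then have "(LEAST n. n \<in> ?W) \<in> ?W"
    by (metis LeastI ex_in_conv)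
  then have "(u, v) \<in> parcs G ^^ (LEAST n. n \<in> ?W)"
    by simp
  moreover have "ereal (real (LEAST n. n \<in> ?W)) \<le> graph_dist G u v"
    unfolding graph_dist_eq_INF_relpow[OF assms(1)]
    by (intro INF_greatest) (simp add: Least_le)
  then have "real (LEAST n. n \<in> ?W) \<le> x"
    using assms(2) by (meson ereal_less_eq(3) order_trans)
  ultimately show ?thesis
    by (rule that)
qed

lemma graph_dist_le_diameter:
  "u \<in> pverts G \<Longrightarrow> v \<in> pverts G \<Longrightarrow> graph_dist G u v \<le> diameter G"
  unfolding diameter_def by (blast intro: SUP_upper2 SUP_upper)

lemma diameter_leI:
  "(\<And>u v. u \<in> pverts G \<Longrightarrow> v \<in> pverts G \<Longrightarrow> graph_dist G u v \<le> d) \<Longrightarrow> diameter G \<le> d"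
  unfolding diameter_def by (intro SUP_least)

lemma relpow_map:
  assumes "\<And>x y. (x, y) \<in> E \<Longrightarrow> (f x, f y) \<in> E'" and "(x, y) \<in> E ^^ n"
  shows "(f x, f y) \<in> E' ^^ n"
  using assms(2) by (induction n arbitrary: y) (auto intro: assms(1))

text \<open>
  A homomorphism maps a walk to a walk of the same length, so the lengths over which the distance
  of the images is minimised include all those available in the source.
\<close>

lemma diameter_le_of_surj_hom:
  assumes "pair_wf_digraph G" "pair_wf_digraph G'"
    and surj: "f ` pverts G = pverts G'"
    and hom: "\<And>u v. (u, v) \<in> parcs G \<Longrightarrow> (f u, f v) \<in> parcs G'"
  shows "diameter G' \<le> diameter G"
proof (rule diameter_leI)
  interpret G: pair_wf_digraph G by fact
  interpret G': pair_wf_digraph G' by fact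
  fix u' v' assume "u' \<in> pverts G'" "v' \<in> pverts G'"
  then obtain u v where uv: "u \<in> pverts G" "v \<in> pverts G" "u' = f u" "v' = f v"
    using surj by blast
  have "graph_dist G' u' v' \<le> graph_dist G u v"
    unfolding uv(3,4) G.graph_dist_eq_INF_relpow[OF uv(1)]
      G'.graph_dist_eq_INF_relpow[OF \<open>u' \<in> pverts G'\<close>[unfolded uv(3)]]
    by (intro INF_superset_mono) (auto intro: relpow_map[OF hom])
  also have "\<dots> \<le> diameter G"
    using uv by (simp add: graph_dist_le_diameter)
  finally show "graph_dist G' u' v' \<le> diameter G" .
qed

context
  fixes G :: "'a pair_pre_digraph" and G' :: "'b pair_pre_digraph" and f :: "'a \<Rightarrow> 'b"
  assumes wf: "pair_wf_digraph G" "pair_wf_digraph G'"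
    and bij: "bij_betw f (pverts G) (pverts G')"
    and arcs: "\<And>u v. u \<in> pverts G \<Longrightarrow> v \<in> pverts G \<Longrightarrow>
      (u, v) \<in> parcs G \<longleftrightarrow> (f u, f v) \<in> parcs G'"
begin

interpretation G: pair_wf_digraph G by (fact wf)
interpretation G': pair_wf_digraph G' by (fact wf)

lemma digraph_iso_of_vertex_bij: "digraph_iso (with_proj G) (with_proj G')"
proof -
  let ?hom = "\<lparr>iso_verts = f, iso_arcs = map_prod f f, iso_head = snd, iso_tail = fst\<rparr>"
  have inj: "inj_on f (pverts G)" and img: "f ` pverts G = pverts G'"
    using bij by (auto simp: bij_betw_def)
  have "inj_on (map_prod f f) (parcs G)"
    by (rule inj_on_subset[OF map_prod_inj_on[OF inj inj]])
      (auto dest: G.in_arcsD1 G.in_arcsD2)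
  then have "G.digraph_isomorphism ?hom"
    using inj G.wf_digraph_axioms by (auto simp: G.digraph_isomorphism_def)
  moreover have "map_prod f f ` parcs G = parcs G'"
  proof (intro equalityI subsetI)
    fix e assume "e \<in> map_prod f f ` parcs G"
    then obtain u v where e: "e = (f u, f v)" and uv: "(u, v) \<in> parcs G"
      by auto
    show "e \<in> parcs G'"
      using arcs[OF G.in_arcsD1[OF uv] G.in_arcsD2[OF uv]] uv e by simp
  next
    fix e assume e: "e \<in> parcs G'"
    then have "fst e \<in> f ` pverts G" "snd e \<in> f ` pverts G"
      unfolding img by (rule G'.arc_fst_in_verts, rule G'.arc_snd_in_verts)
    then obtain u v where uv: "u \<in> pverts G" "v \<in> pverts G" "e = (f u, f v)"
      by (metis imageE prod.collapse)
    then have "(u, v) \<in> parcs G"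
      using arcs e by simp
    then show "e \<in> map_prod f f ` parcs G"
      unfolding uv(3) by (rule rev_image_eqI) simp
  qed
  then have "with_proj G' = app_iso ?hom (with_proj G)"
    by (simp add: app_iso_def with_proj_def img)
  ultimately show ?thesis
    unfolding digraph_iso_def by blast
qed

lemma diameter_eq_of_vertex_bij: "diameter G' = diameter G"
proof (rule antisym)
  have img: "f ` pverts G = pverts G'"
    using bij by (simp add: bij_betw_def)
  show "diameter G' \<le> diameter G"
    using arcs G.in_arcsD1 G.in_arcsD2 by (intro diameter_le_of_surj_hom[where f = f] wf img) blast
  let ?g = "the_inv_into (pverts G) f"
  have g: "bij_betw ?g (pverts G') (pverts G)"
    using bij by (rule bij_betw_the_inv_into)
  have fg: "f (?g x) = x" if "x \<in> pverts G'" for x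
    using bij that by (simp add: f_the_inv_into_f_bij_betw)
  show "diameter G \<le> diameter G'"
  proof (intro diameter_le_of_surj_hom[where f = ?g] wf)
    show "?g ` pverts G' = pverts G"
      using g by (simp add: bij_betw_def)
    show "(?g u, ?g v) \<in> parcs G" if "(u, v) \<in> parcs G'" for u v
      using that arcs[of "?g u" "?g v"] fg G'.in_arcsD1[OF that] G'.in_arcsD2[OF that]
        bij_betwE[OF g] by simp
  qed
qed

end

section \<open>Padding of walks and walks in products\<close>

text \<open>
  The surplus length is spent at the start, going back and forth along the arc to \<open>w\<close>.
\<close>

lemma relpow_pad_even:
  assumes "sym E" "(u, w) \<in> E" "(u, v) \<in> E ^^ n" "n \<le> m" "even n \<longleftrightarrow> even m"
  shows "(u, v) \<in> E ^^ m"
proof -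
  have "(u, u) \<in> E ^^ (2 * k)" for k
  proof (induction k)
    case (Suc k)
    have "(w, u) \<in> E ^^ Suc (2 * k)"
      using Suc symD[OF assms(1,2)] by (rule relpow_Suc_I2[rotated])
    then have "(u, u) \<in> E ^^ Suc (Suc (2 * k))"
      using assms(2) by (rule relpow_Suc_I2[rotated])
    then show ?case by simp
  qed simp
  moreover have "m = 2 * ((m - n) div 2) + n"
    using assms(4,5) by simp
  moreover have "(u, v) \<in> E ^^ (2 * k + n)" if "(u, u) \<in> E ^^ (2 * k)" for k
    using that assms(3) unfolding relpow_add by (rule relcompI)
  ultimately show ?thesis
    by metis
qed

text \<open>
  Both walks must have the same length, since a step in the product moves in both coordinates
  at once.
\<close>

lemma relpow_kronecker_product:
  assumes "(h, h') \<in> parcs H ^^ n" "(k, k') \<in> parcs K ^^ n"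
  shows "((h, k), (h', k')) \<in> parcs (kronecker_product H K) ^^ n"
  using assms
proof (induction n arbitrary: h' k')
  case (Suc n)
  then show ?case
    by (fastforce simp: kronecker_product_def relcomp_unfold)
qed simp

lemma pair_wf_digraph_kronecker_product:
  assumes "pair_wf_digraph H" "pair_wf_digraph K"
  shows "pair_wf_digraph (kronecker_product H K)"
  using assms by (auto simp: pair_wf_digraph_def kronecker_product_def)

lemma pair_sym_digraph_kronecker_product:
  assumes "pair_sym_digraph H" "pair_sym_digraph K"
  shows "pair_sym_digraph (kronecker_product H K)"
proof -
  interpret H: pair_sym_digraph H by fact
  interpret K: pair_sym_digraph K by fact
  interpret pair_wf_digraph "kronecker_product H K"
    by (rule pair_wf_digraph_kronecker_product) unfold_locales
  show ?thesis
    by unfold_locales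
      (auto simp: symmetric_def kronecker_product_def intro!: symI
        intro: H.arcs_symmetric K.arcs_symmetric)
qed

lemma pair_wf_digraph_polarity_quotient: "pair_wf_digraph (polarity_quotient \<rho> G)"
  by (auto simp: pair_wf_digraph_def polarity_quotient_def Let_def)

section \<open>Connected bipartite graphs with a polarity\<close>

locale polarity_graph = pair_sym_digraph G for G :: "'a pair_pre_digraph" +
  fixes A B :: "'a set" and \<rho> :: "'a \<Rightarrow> 'a"
  assumes connected: "connected (with_proj G)"
    and bipartition: "bipartition G A B"
    and polarity: "polarity G A B \<rho>"
begin

lemma \<rho>_in_verts: "v \<in> pverts G \<Longrightarrow> \<rho> v \<in> pverts G"
  using polarity bij_betw_apply unfolding polarity_def graph_automorphism_def by metis

lemma \<rho>_\<rho>: "v \<in> pverts G \<Longrightarrow> \<rho> (\<rho> v) = v"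
  using polarity by (simp add: polarity_def)

lemma \<rho>_arc: "(u, v) \<in> parcs G \<Longrightarrow> (\<rho> u, \<rho> v) \<in> parcs G"
  using polarity in_arcsD1[of u v] in_arcsD2[of u v]
  unfolding polarity_def graph_automorphism_def by blast

lemma \<rho>_swaps_side: "v \<in> pverts G \<Longrightarrow> \<rho> v \<in> A \<longleftrightarrow> v \<notin> A"
proof -
  assume v: "v \<in> pverts G"
  have disj: "A \<inter> B = {}" and cover: "A \<union> B = pverts G" and swap: "\<rho> ` A = B" "\<rho> ` B = A"
    using polarity bipartition by (auto simp: polarity_def bipartition_def)
  show "\<rho> v \<in> A \<longleftrightarrow> v \<notin> A"
    using v disj cover imageI[of v A \<rho>] imageI[of v B \<rho>] unfolding swap by blast
qed

lemma arc_swaps_side: "(u, v) \<in> parcs G \<Longrightarrow> v \<in> A \<longleftrightarrow> u \<notin> A"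
  using bipartition by (auto simp: bipartition_def)

lemma walk_parity: "(u, v) \<in> parcs G ^^ n \<Longrightarrow> even n \<longleftrightarrow> (u \<in> A \<longleftrightarrow> v \<in> A)"
proof (induction n arbitrary: v)
  case (Suc n)
  then show ?case using arc_swaps_side by fastforce
qed simp

lemma verts_nonempty: "pverts G \<noteq> {}"
  using connected by (auto simp: connected_def strongly_connected_def)

lemma walk_between:
  assumes "u \<in> pverts G" "v \<in> pverts G"
  obtains n where "(u, v) \<in> parcs G ^^ n"
proof -
  have "u \<rightarrow>\<^sup>*\<^bsub>with_proj (mk_symmetric (with_proj G))\<^esub> v"
    using connected assms by (auto simp: connected_def strongly_connected_def)
  then have "u \<rightarrow>\<^sup>*\<^bsub>with_proj G\<^esub> v"
    using reachable_mk_symmetric_eq[OF pair_sym_arcs] by simp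
  then have "(u, v) \<in> (parcs G)\<^sup>*"
    using reachable_conv by auto
  then show ?thesis
    using that unfolding rtrancl_power by blast
qed

text \<open>
  A vertex and its image under the polarity lie on opposite sides, so a walk between them is not
  empty; its first arc leads to a neighbour.
\<close>

lemma neighbour:
  assumes "v \<in> pverts G"
  obtains w where "(v, w) \<in> parcs G"
proof -
  obtain n where n: "(v, \<rho> v) \<in> parcs G ^^ n"
    using walk_between assms \<rho>_in_verts by blast
  have "odd n"
    using walk_parity[OF n] \<rho>_swaps_side[OF assms] by blast
  then obtain m where "n = Suc m"
    by (cases n) auto
  with n show ?thesis
    using that by (metis relpow_Suc_D2)
qed

lemma walk_pad:
  assumes "u \<in> pverts G" "(u, v) \<in> parcs G ^^ n" "n \<le> m" "even n \<longleftrightarrow> even m"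
  shows "(u, v) \<in> parcs G ^^ m"
proof -
  obtain w where "(u, w) \<in> parcs G"
    using neighbour[OF assms(1)] .
  moreover have "sym (parcs G)"
    using pair_sym_arcs by (simp add: symmetric_def)
  ultimately show ?thesis
    using relpow_pad_even assms(2-4) by metis
qed

abbreviation Q :: "'a set pair_pre_digraph" where
  "Q \<equiv> polarity_quotient \<rho> G"

lemma quotient_verts: "pverts Q = (\<lambda>v. {v, \<rho> v}) ` pverts G"
  by (simp add: polarity_quotient_def Let_def)

lemma orbit_\<rho>: "v \<in> pverts G \<Longrightarrow> {\<rho> v, \<rho> (\<rho> v)} = {v, \<rho> v}"
  by (auto simp: \<rho>_\<rho>)

lemma quotient_arc: "(u, v) \<in> parcs G \<Longrightarrow> ({u, \<rho> u}, {v, \<rho> v}) \<in> parcs Q"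
  by (auto simp: polarity_quotient_def Let_def dest: in_arcsD1 in_arcsD2)

text \<open>
  The heart of the upper bound. The target orbit has one vertex on each side, so there is a
  representative \<open>w\<close> for which walks from \<open>u\<close> have the parity of \<open>m\<close>. Parity then excludes length
  \<open>m + 1\<close>, which is how the quotient saves one step over the diameter of the graph. The length
  is obtained exactly, not merely as a bound, so that walks in two factors can be synchronised.
\<close>

lemma quotient_walk_of_length:
  assumes bound: "diameter G \<le> ereal x" "x < real m + 2"
    and "X \<in> pverts Q" "Y \<in> pverts Q"
  shows "(X, Y) \<in> parcs Q ^^ m"
proof -
  obtain u v where u: "u \<in> pverts G" "X = {u, \<rho> u}" and v: "v \<in> pverts G" "Y = {v, \<rho> v}"
    using assms(3,4) by (auto simp: quotient_verts)
  obtain w where w: "w \<in> pverts G" "Y = {w, \<rho> w}" "even m \<longleftrightarrow> (u \<in> A \<longleftrightarrow> w \<in> A)"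
    using v orbit_\<rho>[OF v(1)] \<rho>_in_verts[OF v(1)] \<rho>_swaps_side[OF v(1)] by metis
  have "graph_dist G u w \<le> ereal x"
    using graph_dist_le_diameter[OF u(1) w(1)] bound(1) by (rule order_trans)
  then obtain n where n: "(u, w) \<in> parcs G ^^ n" "real n \<le> x"
    using graph_dist_attained[OF u(1)] by blast
  have parity: "even n \<longleftrightarrow> even m"
    using walk_parity[OF n(1)] w(3) by blast
  moreover have "n \<le> Suc m"
    using n(2) bound(2) by linarith
  (* n cannot be m + 1, which has the wrong parity. *)
  ultimately have "n \<le> m"
    by (metis even_Suc le_Suc_eq)
  then have "(u, w) \<in> parcs G ^^ m"
    using walk_pad[OF u(1) n(1)] parity by blast
  from relpow_map[where f = "\<lambda>v. {v, \<rho> v}", OF quotient_arc this] show ?thesis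
    unfolding u(2) w(2) by simp
qed

text \<open>
  The distance from a vertex to its image under the polarity is odd.
\<close>

lemma one_le_diameter: "1 \<le> diameter G"
proof -
  obtain v where v: "v \<in> pverts G"
    using verts_nonempty by blast
  have "1 \<le> graph_dist G v (\<rho> v)"
    unfolding graph_dist_eq_INF_relpow[OF v]
  proof (intro INF_greatest)
    fix n assume "n \<in> {n. (v, \<rho> v) \<in> parcs G ^^ n}"
    then have "odd n"
      using walk_parity \<rho>_swaps_side[OF v] by blast
    then show "1 \<le> ereal (real n)"
      by (simp add: odd_pos Suc_leI)
  qed
  also have "\<dots> \<le> diameter G"
    using v \<rho>_in_verts by (intro graph_dist_le_diameter)
  finally show ?thesis .
qed

end

section \<open>The reduced Kronecker product\<close>

text \<open>
  In a symmetric digraph a strongly connected component is exactly the set of vertices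
  reachable from any one of its members; this turns the maximality in the definition of a component
  into a statement about walks.
\<close>

lemma reduced_kronecker_product_symD:
  assumes "pair_sym_digraph H" "pair_sym_digraph K" "reduced_kronecker_product H K R"
  shows "pverts R \<noteq> {}" "pverts R \<subseteq> pverts H \<times> pverts K"
    and "parcs R = {(p, q) \<in> parcs (kronecker_product H K). p \<in> pverts R \<and> q \<in> pverts R}"
    and "\<And>p q. p \<in> pverts R \<Longrightarrow> q \<in> pverts H \<times> pverts K \<Longrightarrow>
      q \<in> pverts R \<longleftrightarrow> (\<exists>n. (p, q) \<in> parcs (kronecker_product H K) ^^ n)"
proof -
  interpret P: pair_sym_digraph "kronecker_product H K"
    using assms(1,2) by (rule pair_sym_digraph_kronecker_product)
  have R: "with_proj R \<in> P.sccs"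
    using assms(3) by (simp add: reduced_kronecker_product_def)
  have verts: "pverts (kronecker_product H K) = pverts H \<times> pverts K"
    by (simp add: kronecker_product_def)
  have "pverts R \<in> verts ` P.sccs"
    using R by (metis image_eqI with_proj_simps(1))
  then have S: "pverts R \<in> P.sccs_verts"
    by (rule P.in_sccs_vertsI_sccs)
  then show "pverts R \<noteq> {}"
    by (simp add: P.in_sccs_verts_conv_reachable)
  have ind: "induced_subgraph (with_proj R) (with_proj (kronecker_product H K))"
    using R by (rule P.in_sccs_imp_induced)
  then show sub: "pverts R \<subseteq> pverts H \<times> pverts K"
    using verts by (metis induced_imp_subgraph subgraph_imp_subverts with_proj_simps(1))
  show "parcs R = {(p, q) \<in> parcs (kronecker_product H K). p \<in> pverts R \<and> q \<in> pverts R}"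
    using conjunct2[OF ind[unfolded induced_subgraph_def]] by (auto simp: split_def)
  fix p q assume p: "p \<in> pverts R" and q: "q \<in> pverts H \<times> pverts K"
  have "q \<in> pverts R \<longleftrightarrow> p \<rightarrow>\<^sup>*\<^bsub>kronecker_product H K\<^esub> q"
    using S p P.symmetric_reachable'[of p q]
    unfolding P.in_sccs_verts_conv_reachable by meson
  also have "\<dots> \<longleftrightarrow> (p, q) \<in> (parcs (kronecker_product H K))\<^sup>*"
    using P.reachable_conv p q sub verts by auto
  also have "\<dots> \<longleftrightarrow> (\<exists>n. (p, q) \<in> parcs (kronecker_product H K) ^^ n)"
    by (rule rtrancl_power)
  finally show "q \<in> pverts R \<longleftrightarrow> (\<exists>n. (p, q) \<in> parcs (kronecker_product H K) ^^ n)" .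
qed

locale polarity_product =
  H: polarity_graph H A\<^sub>H B\<^sub>H \<rho>\<^sub>H + K: polarity_graph K A\<^sub>K B\<^sub>K \<rho>\<^sub>K
  for H :: "'a pair_pre_digraph" and A\<^sub>H B\<^sub>H \<rho>\<^sub>H
    and K :: "'b pair_pre_digraph" and A\<^sub>K B\<^sub>K \<rho>\<^sub>K +
  fixes R :: "('a \<times> 'b) pair_pre_digraph"
  assumes reduced: "reduced_kronecker_product H K R"
begin

lemmas R_component = reduced_kronecker_product_symD
  [OF H.pair_sym_digraph_axioms K.pair_sym_digraph_axioms reduced]

text \<open>
  Walks in the two factors can be padded to a common length exactly when their parities agree, and
  these parities are read off from the sides of the end points.
\<close>

lemma kronecker_walk_iff:
  assumes "h \<in> pverts H" "k \<in> pverts K" "h' \<in> pverts H" "k' \<in> pverts K"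
  shows "(\<exists>n. ((h, k), (h', k')) \<in> parcs (kronecker_product H K) ^^ n) \<longleftrightarrow>
    ((h \<in> A\<^sub>H \<longleftrightarrow> h' \<in> A\<^sub>H) \<longleftrightarrow> (k \<in> A\<^sub>K \<longleftrightarrow> k' \<in> A\<^sub>K))"
proof
  assume "\<exists>n. ((h, k), (h', k')) \<in> parcs (kronecker_product H K) ^^ n"
  then obtain n where n: "((h, k), (h', k')) \<in> parcs (kronecker_product H K) ^^ n" ..
  have "(fst (h, k), fst (h', k')) \<in> parcs H ^^ n" "(snd (h, k), snd (h', k')) \<in> parcs K ^^ n"
    by (rule relpow_map[OF _ n]; auto simp: kronecker_product_def)+
  then show "(h \<in> A\<^sub>H \<longleftrightarrow> h' \<in> A\<^sub>H) \<longleftrightarrow> (k \<in> A\<^sub>K \<longleftrightarrow> k' \<in> A\<^sub>K)"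
    using H.walk_parity K.walk_parity by (metis fst_conv snd_conv)
next
  assume sides: "(h \<in> A\<^sub>H \<longleftrightarrow> h' \<in> A\<^sub>H) \<longleftrightarrow> (k \<in> A\<^sub>K \<longleftrightarrow> k' \<in> A\<^sub>K)"
  obtain i where i: "(h, h') \<in> parcs H ^^ i"
    using H.walk_between assms by blast
  obtain j where j: "(k, k') \<in> parcs K ^^ j"
    using K.walk_between assms by blast
  have "even i \<longleftrightarrow> even j"
    using sides H.walk_parity[OF i] K.walk_parity[OF j] by blast
  then have "(h, h') \<in> parcs H ^^ max i j" "(k, k') \<in> parcs K ^^ max i j"
    using H.walk_pad[OF assms(1) i] K.walk_pad[OF assms(2) j] by (auto simp: max_def)
  then show "\<exists>n. ((h, k), (h', k')) \<in> parcs (kronecker_product H K) ^^ n"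
    by (intro exI relpow_kronecker_product)
qed

lemma in_R_iff_sides:
  assumes "(h, k) \<in> pverts R" "h' \<in> pverts H" "k' \<in> pverts K"
  shows "(h', k') \<in> pverts R \<longleftrightarrow> ((h \<in> A\<^sub>H \<longleftrightarrow> h' \<in> A\<^sub>H) \<longleftrightarrow> (k \<in> A\<^sub>K \<longleftrightarrow> k' \<in> A\<^sub>K))"
proof -
  have "h \<in> pverts H" "k \<in> pverts K"
    using R_component(2) assms(1) by auto
  then show ?thesis
    using R_component(4)[OF assms(1), of "(h', k')"] kronecker_walk_iff[of h k h' k'] assms by simp
qed

lemma R_subset: "(h, k) \<in> pverts R \<Longrightarrow> h \<in> pverts H \<and> k \<in> pverts K"
  using R_component(2) by blast

text \<open>
  A polarity switches the side of the coordinate to which it is applied; one switch leaves the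
  component, two switches return to it.
\<close>

lemma in_R_or_flip:
  assumes "h \<in> pverts H" "k \<in> pverts K"
  shows "(\<rho>\<^sub>H h, k) \<in> pverts R \<longleftrightarrow> (h, k) \<notin> pverts R"
    and "(h, \<rho>\<^sub>K k) \<in> pverts R \<longleftrightarrow> (h, k) \<notin> pverts R"
    and "(\<rho>\<^sub>H h, \<rho>\<^sub>K k) \<in> pverts R \<longleftrightarrow> (h, k) \<in> pverts R"
proof -
  obtain h0 k0 where "(h0, k0) \<in> pverts R"
    using R_component(1) by auto
  note iff = in_R_iff_sides[OF this]
  show "(\<rho>\<^sub>H h, k) \<in> pverts R \<longleftrightarrow> (h, k) \<notin> pverts R"
    and "(h, \<rho>\<^sub>K k) \<in> pverts R \<longleftrightarrow> (h, k) \<notin> pverts R"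
    and "(\<rho>\<^sub>H h, \<rho>\<^sub>K k) \<in> pverts R \<longleftrightarrow> (h, k) \<in> pverts R"
    using assms
    by (auto simp: iff H.\<rho>_in_verts K.\<rho>_in_verts H.\<rho>_swaps_side K.\<rho>_swaps_side)
qed

text \<open>
  Membership of the second vertex in \<open>R\<close> is automatic: an arc of the product switches
  sides in both coordinates and so stays in the component.
\<close>

lemma R_arc_iff:
  assumes "(h, k) \<in> pverts R"
  shows "((h, k), (h', k')) \<in> parcs R \<longleftrightarrow> (h, h') \<in> parcs H \<and> (k, k') \<in> parcs K"
proof
  assume "((h, k), (h', k')) \<in> parcs R"
  then show "(h, h') \<in> parcs H \<and> (k, k') \<in> parcs K"
    by (auto simp: R_component(3) kronecker_product_def)
next
  assume arcs: "(h, h') \<in> parcs H \<and> (k, k') \<in> parcs K"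
  then have "(h', k') \<in> pverts R"
    using in_R_iff_sides[OF assms] H.in_arcsD2 K.in_arcsD2 H.arc_swaps_side K.arc_swaps_side
    by blast
  with arcs assms show "((h, k), (h', k')) \<in> parcs R"
    by (auto simp: R_component(3) kronecker_product_def)
qed

abbreviation PP :: "('a set \<times> 'b set) pair_pre_digraph" where
  "PP \<equiv> kronecker_product (polarity_quotient \<rho>\<^sub>H H) (polarity_quotient \<rho>\<^sub>K K)"

abbreviation PR :: "('a \<times> 'b) set pair_pre_digraph" where
  "PR \<equiv> polarity_quotient (map_prod \<rho>\<^sub>H \<rho>\<^sub>K) R"

text \<open>
  The isomorphism. Intersecting with the vertices of \<open>R\<close> picks, from the four pairs with
  coordinates in two orbits, the two that form an orbit of the composed polarity.
\<close>

definition merge :: "'a set \<times> 'b set \<Rightarrow> ('a \<times> 'b) set" where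
  "merge = (\<lambda>(X, Y). X \<times> Y \<inter> pverts R)"

text \<open>
  Representatives can be chosen inside \<open>R\<close>: if a chosen pair lies in the other
  component, replacing its first coordinate by its image under the polarity repairs this.
\<close>

lemma PP_vertexE:
  assumes "p \<in> pverts PP"
  obtains h k where "(h, k) \<in> pverts R" "p = ({h, \<rho>\<^sub>H h}, {k, \<rho>\<^sub>K k})"
proof -
  obtain h k where hk: "h \<in> pverts H" "k \<in> pverts K" "p = ({h, \<rho>\<^sub>H h}, {k, \<rho>\<^sub>K k})"
    using assms by (auto simp: kronecker_product_def H.quotient_verts K.quotient_verts)
  then show ?thesis
    using that[of h k] that[of "\<rho>\<^sub>H h" k] in_R_or_flip(1) H.orbit_\<rho> by metis
qed

lemma merge_orbits:
  assumes "(h, k) \<in> pverts R"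
  shows "merge ({h, \<rho>\<^sub>H h}, {k, \<rho>\<^sub>K k}) = {(h, k), (\<rho>\<^sub>H h, \<rho>\<^sub>K k)}"
proof -
  have "h \<in> pverts H" "k \<in> pverts K"
    using R_subset[OF assms] by simp_all
  note in_R_or_flip[OF this]
  then show ?thesis
    using assms by (auto simp: merge_def)
qed

lemma bij_betw_merge: "bij_betw merge (pverts PP) (pverts PR)"
proof (intro bij_betw_imageI inj_onI)
  (* Both orbits can be recovered from the merged orbit by projection. *)
  have split: "(fst ` merge p, snd ` merge p) = p" if "p \<in> pverts PP" for p
    using that by (rule PP_vertexE) (simp add: merge_orbits)
  fix p q assume "p \<in> pverts PP" "q \<in> pverts PP" "merge p = merge q"
  then show "p = q"
    using split by metis
next
  show "merge ` pverts PP = pverts PR"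
  proof (intro equalityI subsetI)
    fix Z assume "Z \<in> merge ` pverts PP"
    then obtain h k where "(h, k) \<in> pverts R" "Z = {(h, k), (\<rho>\<^sub>H h, \<rho>\<^sub>K k)}"
      by (auto elim!: PP_vertexE simp: merge_orbits)
    then show "Z \<in> pverts PR"
      by (force simp: polarity_quotient_def Let_def)
  next
    fix Z assume "Z \<in> pverts PR"
    then obtain h k where hk: "(h, k) \<in> pverts R" "Z = {(h, k), (\<rho>\<^sub>H h, \<rho>\<^sub>K k)}"
      by (auto simp: polarity_quotient_def Let_def)
    then have "({h, \<rho>\<^sub>H h}, {k, \<rho>\<^sub>K k}) \<in> pverts PP"
      using R_subset by (auto simp: kronecker_product_def H.quotient_verts K.quotient_verts)
    then show "Z \<in> merge ` pverts PP"
      using merge_orbits[OF hk(1)] hk(2) by (intro image_eqI) auto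
  qed
qed

text \<open>
  An arc of the product of quotients is witnessed by arcs of \<open>H\<close> and \<open>K\<close>, which together give an
  arc of the Kronecker product, possibly in the wrong component. In that case, applying the
  polarity to the arc of \<open>H\<close> keeps the orbits and moves the arc into \<open>R\<close>.
\<close>

lemma merge_arc_iff:
  assumes "p \<in> pverts PP" "q \<in> pverts PP"
  shows "(p, q) \<in> parcs PP \<longleftrightarrow> (merge p, merge q) \<in> parcs PR"
proof -
  obtain X Y X' Y' where pq: "p = (X, Y)" "q = (X', Y')"
    by (cases p, cases q)
  have verts: "merge p \<in> pverts PR" "merge q \<in> pverts PR"
    using assms bij_betwE[OF bij_betw_merge] by blast+
  have orb: "X \<in> pverts H.Q" "X' \<in> pverts H.Q" "Y \<in> pverts K.Q" "Y' \<in> pverts K.Q"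
    using assms pq by (auto simp: kronecker_product_def)
  have "(p, q) \<in> parcs PP \<longleftrightarrow>
      (\<exists>h\<in>X. \<exists>h'\<in>X'. \<exists>k\<in>Y. \<exists>k'\<in>Y'. (h, h') \<in> parcs H \<and> (k, k') \<in> parcs K)"
    using orb unfolding pq by (auto simp: kronecker_product_def polarity_quotient_def Let_def)
  also have "\<dots> \<longleftrightarrow> (\<exists>v\<in>merge p. \<exists>w\<in>merge q. (v, w) \<in> parcs R)"
  proof
    assume "\<exists>h\<in>X. \<exists>h'\<in>X'. \<exists>k\<in>Y. \<exists>k'\<in>Y'. (h, h') \<in> parcs H \<and> (k, k') \<in> parcs K"
    then obtain h h' k k' where
      mem: "h \<in> X" "h' \<in> X'" "k \<in> Y" "k' \<in> Y'"
      and arcs: "(h, h') \<in> parcs H" "(k, k') \<in> parcs K"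
      by blast
    have flip: "\<rho>\<^sub>H h \<in> X" "\<rho>\<^sub>H h' \<in> X'"
      using mem orb by (auto simp: H.quotient_verts H.\<rho>_\<rho>)
    have witness: "\<exists>v\<in>merge p. \<exists>w\<in>merge q. (v, w) \<in> parcs R"
      if "a \<in> X" "a' \<in> X'" "(a, a') \<in> parcs H" "(a, k) \<in> pverts R" for a a'
    proof -
      have arc: "((a, k), (a', k')) \<in> parcs R"
        using R_arc_iff[OF that(4)] that(3) arcs(2) by blast
      then have "(a', k') \<in> pverts R"
        by (auto simp: R_component(3))
      with that mem have "(a, k) \<in> merge p" "(a', k') \<in> merge q"
        by (auto simp: merge_def pq)
      with arc show ?thesis by blast
    qed
    show "\<exists>v\<in>merge p. \<exists>w\<in>merge q. (v, w) \<in> parcs R"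
    proof (cases "(h, k) \<in> pverts R")
      case True
      then show ?thesis using witness mem arcs by blast
    next
      case False
      then have "(\<rho>\<^sub>H h, k) \<in> pverts R"
        using in_R_or_flip(1) H.in_arcsD1[OF arcs(1)] K.in_arcsD1[OF arcs(2)] by blast
      then show ?thesis
        using witness flip H.\<rho>_arc[OF arcs(1)] by blast
    qed
  next
    assume "\<exists>v\<in>merge p. \<exists>w\<in>merge q. (v, w) \<in> parcs R"
    then obtain h k h' k' where "(h, k) \<in> merge p" "(h', k') \<in> merge q"
      "((h, k), (h', k')) \<in> parcs R"
      by (metis surj_pair)
    then show "\<exists>h\<in>X. \<exists>h'\<in>X'. \<exists>k\<in>Y. \<exists>k'\<in>Y'. (h, h') \<in> parcs H \<and> (k, k') \<in> parcs K"
      using R_arc_iff by (auto simp: merge_def pq)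
  qed
  also have "\<dots> \<longleftrightarrow> (merge p, merge q) \<in> parcs PR"
    using verts by (auto simp: polarity_quotient_def Let_def)
  finally show ?thesis .
qed

lemma pair_wf_digraph_PP: "pair_wf_digraph PP"
  by (intro pair_wf_digraph_kronecker_product pair_wf_digraph_polarity_quotient)

lemma PP_iso_PR: "digraph_iso (with_proj PP) (with_proj PR)"
  by (rule digraph_iso_of_vertex_bij[where f = merge])
    (fact pair_wf_digraph_PP pair_wf_digraph_polarity_quotient bij_betw_merge merge_arc_iff)+

lemma diameter_PR: "diameter PR = diameter PP"
  by (rule diameter_eq_of_vertex_bij[where f = merge])
    (fact pair_wf_digraph_PP pair_wf_digraph_polarity_quotient bij_betw_merge merge_arc_iff)+

lemma diameter_PP_ge: "max (diameter H.Q) (diameter K.Q) \<le> diameter PP"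
proof -
  have "pverts H.Q \<noteq> {}" "pverts K.Q \<noteq> {}"
    using H.verts_nonempty K.verts_nonempty by (simp_all add: H.quotient_verts K.quotient_verts)
  then have "fst ` pverts PP = pverts H.Q" "snd ` pverts PP = pverts K.Q"
    by (simp_all add: kronecker_product_def)
  then have "diameter H.Q \<le> diameter PP" "diameter K.Q \<le> diameter PP"
    using diameter_le_of_surj_hom[OF pair_wf_digraph_PP pair_wf_digraph_polarity_quotient, where f = fst]
      diameter_le_of_surj_hom[OF pair_wf_digraph_PP pair_wf_digraph_polarity_quotient, where f = snd]
    by (auto simp: kronecker_product_def)
  then show ?thesis by simp
qed

text \<open>
  If the maximum is infinite there is nothing to prove. Otherwise walks of one common length
  \<open>m\<close> in both quotients are combined.
\<close>

lemma diameter_PP_le: "diameter PP \<le> max (diameter H) (diameter K) - 1"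
proof (cases "max (diameter H) (diameter K)")
  case (real x)
  interpret PP: pair_wf_digraph PP by (rule pair_wf_digraph_PP)
  have bound: "diameter H \<le> ereal x" "diameter K \<le> ereal x"
    using real by (metis max.cobounded1, metis max.cobounded2)
  have "1 \<le> ereal x"
    using H.one_le_diameter bound(1) by (rule order_trans)
  then have "1 \<le> x" by simp
  (* Distances are integers, so only the integer part of x matters. Since x is at least 1,
     the truncated subtraction of 1 is a genuine one. *)
  define m where "m = nat \<lfloor>x\<rfloor> - 1"
  have m: "real m \<le> x - 1" "x < real m + 2"
    using \<open>1 \<le> x\<close> unfolding m_def by linarith+
  have "diameter PP \<le> ereal (real m)"
  proof (rule diameter_leI)
    fix p q assume p: "p \<in> pverts PP" and q: "q \<in> pverts PP"
    then have "(fst p, fst q) \<in> parcs H.Q ^^ m" "(snd p, snd q) \<in> parcs K.Q ^^ m"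
      using H.quotient_walk_of_length[OF bound(1) m(2)] K.quotient_walk_of_length[OF bound(2) m(2)]
      by (auto simp: kronecker_product_def)
    then have "(p, q) \<in> parcs PP ^^ m"
      by (metis relpow_kronecker_product prod.collapse)
    with p show "graph_dist PP p q \<le> ereal (real m)"
      by (rule PP.graph_dist_le_relpow)
  qed
  also have "\<dots> \<le> ereal x - 1"
    using m(1) by (simp add: one_ereal_def)
  finally show ?thesis
    unfolding real .
next
  case MInf
  then have "diameter H \<le> - \<infinity>" by (metis max.cobounded1)
  with H.one_le_diameter have "1 \<le> (- \<infinity> :: ereal)" by (rule order_trans)
  then show ?thesis by simp
qed simp

end

theorem theorem1p2:
  fixes H :: "'a pair_pre_digraph" and K :: "'b pair_pre_digraph"
    and R :: "('a \<times> 'b) pair_pre_digraph"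
    and A\<^sub>H B\<^sub>H :: "'a set" and A\<^sub>K B\<^sub>K :: "'b set"
    and \<rho>\<^sub>H :: "'a \<Rightarrow> 'a" and \<rho>\<^sub>K :: "'b \<Rightarrow> 'b"
  assumes "pair_sym_digraph H" and "connected (with_proj H)"
    and "bipartition H A\<^sub>H B\<^sub>H" and "polarity H A\<^sub>H B\<^sub>H \<rho>\<^sub>H"
    and "pair_sym_digraph K" and "connected (with_proj K)"
    and "bipartition K A\<^sub>K B\<^sub>K" and "polarity K A\<^sub>K B\<^sub>K \<rho>\<^sub>K"
    and "reduced_kronecker_product H K R"
  shows "digraph_iso
      (with_proj (kronecker_product (polarity_quotient \<rho>\<^sub>H H) (polarity_quotient \<rho>\<^sub>K K)))
      (with_proj (polarity_quotient (map_prod \<rho>\<^sub>H \<rho>\<^sub>K) R)) \<and>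
    (\<exists>D. diameter (kronecker_product (polarity_quotient \<rho>\<^sub>H H) (polarity_quotient \<rho>\<^sub>K K)) = D \<and>
      diameter (polarity_quotient (map_prod \<rho>\<^sub>H \<rho>\<^sub>K) R) = D \<and>
      max (diameter (polarity_quotient \<rho>\<^sub>H H)) (diameter (polarity_quotient \<rho>\<^sub>K K)) \<le> D \<and>
      D \<le> max (diameter H) (diameter K) - 1)"
proof -
  interpret polarity_product H A\<^sub>H B\<^sub>H \<rho>\<^sub>H K A\<^sub>K B\<^sub>K \<rho>\<^sub>K R
    using assms
    by (simp add: polarity_product_def polarity_graph_def polarity_graph_axioms_def
        polarity_product_axioms_def)
  show ?thesis
    using PP_iso_PR diameter_PR diameter_PP_ge diameter_PP_le by blast
qed

end
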